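(* Let $d\ge1$, let $K>0$, and let $\Psi$ be a nondecreasing functional on the class of nonnegative integer-valued random variables. Assume that for every finitary coding $\varphi:A^{\mathbb{Z}^d}\to B^{\mathbb{Z}^d}$ ($A,B$ standard Borel spaces), every i.i.d. input $X$, every local observable $f:B^{\mathbb{Z}^d}\to\mathbb{R}$, and every $n\in\mathbb{N}$, $$\mathbb{E}\sum_{i\in\mathbb{Z}^d}\big(c_i^{(n)}(X)\big)^2\le K\,\|\delta f\|_2^2\,\Psi\big(r_\varphi^{(n)}(X)\big).$$ Then necessarily, for every such $\varphi$, $X$ and $n$, $$\mathbb{E}\,|B_\infty(0,r_\varphi^{(n)}(X))|\le K\,\Psi\big(r_\varphi^{(n)}(X)\big).$$
   Context: $T^j$: shifts $(T^jx)_i=x_{i+j}$. $B_\infty(0,r)=\{i\in\mathbb{Z}^d:\|i\|_\infty\le r\}$. A coding map is a measurable $\varphi:A^{\mathbb{Z}^d}\to B^{\mathbb{Z}^d}$ commuting with shifts; its coding radius is $r_\varphi(x)=\inf\{r\in\mathbb{N}_0:\forall x',\ x'_{B_\infty(0,r)}=x_{B_\infty(0,r)}\Rightarrow\varphi(x')_0=\varphi(x)_0\}$ ($\inf\emptyset=\infty$); $\varphi$ is finitary (with respect to $X$) if $r_\varphi(X)<\infty$ a.s. The truncated radius is $r^{(n)}_\varphi(x)=\min\{r_\varphi(x),n\}$. For $f:B^{\mathbb{Z}^d}\to\mathbb{R}$ measurable, $\delta_jf=\sup\{|f(y)-f(y')|:y_\ell=y'_\ell\ \forall\ell\ne j\}$,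 $\mathrm{dep}(f)=\{j:\delta_jf>0\}$, $\|\delta f\|_2^2=\sum_j(\delta_jf)^2$; $f$ is local if $\mathrm{dep}(f)$ is finite and $f$ depends only on coordinates in $\mathrm{dep}(f)$. Finally $$c_i^{(n)}(x)=\sum_{j\in\mathrm{dep}(f)}\delta_jf\;\mathbf 1\{\|j-i\|_\infty\le r_\varphi^{(n)}(T^jx)\},\qquad i\in\mathbb{Z}^d.$$ *)

theory Defs
  imports "HOL-Probability.Probability"
begin

text \<open>The lattice \<open>\<int>\<^sup>d\<close> is the type \<^typ>\<open>int ^ 'd\<close>, where \<open>d = CARD('d) \<ge> 1\<close>.\<close>

definition linf :: "int ^ 'd \<Rightarrow> nat" where
  "linf i = Max (range (\<lambda>k. nat \<bar>i $ k\<bar>))"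

definition linf_ball :: "nat \<Rightarrow> (int ^ 'd) set" where
  "linf_ball r = {i. linf i \<le> r}"

text \<open>Spaces are carried by \<^typ>\<open>'a measure\<close>; only the carrier and the sigma-algebra matter,
  the measure itself is ignored. Polish is used in its usual form, separable and completely
  metrizable. Quantifying over all standard Borel \<open>B :: 'b measure\<close> covers nontrivial spaces only if
  the type \<open>'b\<close> has two elements; \<open>B\<close> itself may still be a single point.\<close>

definition standard_borel :: "'a measure \<Rightarrow> bool" where
  "standard_borel A \<longleftrightarrow>
     (\<exists>T. completely_metrizable_space T \<and> separable_space T \<and>
          space A = topspace T \<and> sets A = sigma_sets (topspace T) {U. openin T U})"

abbreviation config :: "'a measure \<Rightarrow> (int ^ 'd \<Rightarrow> 'a) measure" where
  "config A \<equiv> (\<Pi>\<^sub>M i\<in>UNIV. A)"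

definition shift :: "int ^ 'd \<Rightarrow> (int ^ 'd \<Rightarrow> 'a) \<Rightarrow> int ^ 'd \<Rightarrow> 'a" where
  "shift j x = (\<lambda>i. x (i + j))"

definition coding_map ::
  "'a measure \<Rightarrow> 'b measure \<Rightarrow> ((int ^ 'd \<Rightarrow> 'a) \<Rightarrow> int ^ 'd \<Rightarrow> 'b) \<Rightarrow> bool" where
  "coding_map A B \<phi> \<longleftrightarrow>
     \<phi> \<in> config A \<rightarrow>\<^sub>M config B \<and>
     (\<forall>j. \<forall>x\<in>space (config A). \<phi> (shift j x) = shift j (\<phi> x))"

text \<open>In \<^typ>\<open>enat\<close>, \<open>Inf {} = \<infinity>\<close>.\<close>

definition coding_radius ::
  "'a measure \<Rightarrow> ((int ^ 'd \<Rightarrow> 'a) \<Rightarrow> int ^ 'd \<Rightarrow> 'b) \<Rightarrow> (int ^ 'd \<Rightarrow> 'a) \<Rightarrow> enat" where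
  "coding_radius A \<phi> x =
     Inf {enat r | r. \<forall>x'\<in>space (config A). (\<forall>i\<in>linf_ball r. x' i = x i) \<longrightarrow> \<phi> x' 0 = \<phi> x 0}"

definition truncated_radius ::
  "'a measure \<Rightarrow> ((int ^ 'd \<Rightarrow> 'a) \<Rightarrow> int ^ 'd \<Rightarrow> 'b) \<Rightarrow> nat \<Rightarrow> (int ^ 'd \<Rightarrow> 'a) \<Rightarrow> nat" where
  "truncated_radius A \<phi> n x = the_enat (min (coding_radius A \<phi> x) (enat n))"

definition iid_input :: "'w measure \<Rightarrow> 'a measure \<Rightarrow> ('w \<Rightarrow> int ^ 'd \<Rightarrow> 'a) \<Rightarrow> bool" where
  "iid_input M A X \<longleftrightarrow>
     prob_space M \<and> X \<in> M \<rightarrow>\<^sub>M config A \<and>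
     prob_space.indep_vars M (\<lambda>_. A) (\<lambda>i \<omega>. X \<omega> i) UNIV \<and>
     (\<forall>i. distr M A (\<lambda>\<omega>. X \<omega> i) = distr M A (\<lambda>\<omega>. X \<omega> 0))"

definition finitary_coding ::
  "'a measure \<Rightarrow> 'b measure \<Rightarrow> 'w measure \<Rightarrow> ('w \<Rightarrow> int ^ 'd \<Rightarrow> 'a) \<Rightarrow>
    ((int ^ 'd \<Rightarrow> 'a) \<Rightarrow> int ^ 'd \<Rightarrow> 'b) \<Rightarrow> bool" where
  "finitary_coding A B M X \<phi> \<longleftrightarrow>
     coding_map A B \<phi> \<and> (AE \<omega> in M. coding_radius A \<phi> (X \<omega>) < \<infinity>)"

text \<open>The oscillation takes values in \<open>[0, \<infinity>]\<close>, because observables may be unbounded.\<close>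

definition osc :: "'b measure \<Rightarrow> ((int ^ 'd \<Rightarrow> 'b) \<Rightarrow> real) \<Rightarrow> int ^ 'd \<Rightarrow> ennreal" where
  "osc B f j =
     Sup {ennreal \<bar>f y - f y'\<bar> | y y'.
            y \<in> space (config B) \<and> y' \<in> space (config B) \<and> (\<forall>l. l \<noteq> j \<longrightarrow> y l = y' l)}"

definition dep :: "'b measure \<Rightarrow> ((int ^ 'd \<Rightarrow> 'b) \<Rightarrow> real) \<Rightarrow> (int ^ 'd) set" where
  "dep B f = {j. osc B f j > 0}"

definition osc_norm_sq :: "'b measure \<Rightarrow> ((int ^ 'd \<Rightarrow> 'b) \<Rightarrow> real) \<Rightarrow> ennreal" where
  "osc_norm_sq B f = (\<Sum>\<^sub>\<infinity>j. (osc B f j)\<^sup>2)"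

definition local_observable :: "'b measure \<Rightarrow> ((int ^ 'd \<Rightarrow> 'b) \<Rightarrow> real) \<Rightarrow> bool" where
  "local_observable B f \<longleftrightarrow>
     f \<in> borel_measurable (config B) \<and> finite (dep B f) \<and>
     (\<forall>y\<in>space (config B). \<forall>y'\<in>space (config B). (\<forall>j\<in>dep B f. y j = y' j) \<longrightarrow> f y = f y')"

definition influence ::
  "'a measure \<Rightarrow> 'b measure \<Rightarrow> ((int ^ 'd \<Rightarrow> 'a) \<Rightarrow> int ^ 'd \<Rightarrow> 'b) \<Rightarrow>
    ((int ^ 'd \<Rightarrow> 'b) \<Rightarrow> real) \<Rightarrow> nat \<Rightarrow> int ^ 'd \<Rightarrow> (int ^ 'd \<Rightarrow> 'a) \<Rightarrow> ennreal" where
  "influence A B \<phi> f n i x =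
     (\<Sum>j\<in>dep B f. osc B f j * of_bool (linf (j - i) \<le> truncated_radius A \<phi> n (shift j x)))"

text \<open>A functional of random variables receives the underlying probability space together with the
  variable, so that it is not assumed to depend on the law only. Random variables are taken
  measurable with respect to the completion: the events \<open>coding_radius A \<phi> x \<le> r\<close> are
  coanalytic, hence universally measurable, but in general not Borel. The Lebesgue integral is not
  affected, by \<open>nn_integral_completion\<close>.\<close>

definition nondecreasing_functional :: "('w measure \<Rightarrow> ('w \<Rightarrow> nat) \<Rightarrow> ereal) \<Rightarrow> bool" where
  "nondecreasing_functional \<Psi> \<longleftrightarrow>
     (\<forall>M R S. prob_space M \<longrightarrow>
        R \<in> completion M \<rightarrow>\<^sub>M count_space UNIV \<longrightarrow> S \<in> completion M \<rightarrow>\<^sub>M count_space UNIV \<longrightarrow>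
        (AE \<omega> in M. R \<omega> \<le> S \<omega>) \<longrightarrow> \<Psi> M R \<le> \<Psi> M S)"

end

theory Submission
  imports Defs
begin

text \<open>Test the assumed bound on the observable \<open>f y = \<one>{y 0 = b}\<close> for a point \<open>b\<close> of \<open>B\<close>. If \<open>B\<close> has
  a second point, then \<open>f\<close> has oscillation 1 at the origin and 0 elsewhere, so the influence at \<open>i\<close> is
  the indicator of \<open>i \<in> B\<^sub>\<infinity>(0, r)\<close>, and the assumed bound is the claimed one. If \<open>B\<close> is a single point,
  the radius of every coding vanishes; the claim then reads \<open>1 \<le> K \<Psi>(0)\<close>, which follows from the first
  case applied to a constant coding into a two-point space.\<close>

lemma linf_le_iff: "linf (i :: int ^ 'd) \<le> r \<longleftrightarrow> (\<forall>k. \<bar>i $ k\<bar> \<le> int r)"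
  unfolding linf_def by (subst Max_le_iff) (auto simp: nat_le_iff)

text \<open>Reading off coordinates embeds the ball into the functions from a finite index type to
  an integer interval. Finiteness gives \<open>card\<close> its intended meaning and lets a sum of
  ones over the ball be evaluated.\<close>

lemma finite_linf_ball: "finite (linf_ball r :: (int ^ 'd) set)"
proof -
  have "inj_on (\<lambda>i k. i $ k) (linf_ball r :: (int ^ 'd) set)"
    by (auto simp: inj_on_def vec_eq_iff fun_eq_iff)
  moreover have "(\<lambda>i k. i $ k) ` (linf_ball r :: (int ^ 'd) set) \<subseteq> PiE UNIV (\<lambda>_. {- int r..int r})"
    by (auto simp: linf_ball_def linf_le_iff abs_le_iff minus_le_iff)
  ultimately show ?thesis
    by (rule inj_on_finite) (simp add: finite_PiE)
qed

lemma linf_uminus: "linf (- i) = linf i"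
  by (simp add: linf_def)

text \<open>Radius 0 already qualifies in the infimum. This serves both codings into a one-point
  space and constant codings.\<close>

lemma coding_radius_eq_0:
  assumes "\<And>x'. x' \<in> space (config A) \<Longrightarrow> \<phi> x' 0 = \<phi> x 0"
  shows "coding_radius A \<phi> x = 0"
proof -
  have "coding_radius A \<phi> x \<le> enat 0"
    unfolding coding_radius_def by (rule Inf_lower) (use assms in auto)
  then show ?thesis
    by (simp add: zero_enat_def[symmetric])
qed

lemma truncated_radius_eq_0: "coding_radius A \<phi> x = 0 \<Longrightarrow> truncated_radius A \<phi> n x = 0"
  by (simp add: truncated_radius_def zero_enat_def)

text \<open>Metrizable spaces are T1, so a point is the complement of an open set. This makes the
  test observable measurable.\<close>

lemma standard_borel_singleton_sets:
  assumes "standard_borel B" "b \<in> space B"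
  shows "{b} \<in> sets B"
proof -
  obtain T where T: "completely_metrizable_space T" "space B = topspace T"
    "sets B = sigma_sets (topspace T) {U. openin T U}"
    using assms(1) by (auto simp: standard_borel_def)
  have "closedin T {b}"
    using T assms(2) completely_metrizable_imp_metrizable_space metrizable_imp_t1_space
      closedin_t1_singleton by metis
  then have "space B - {b} \<in> sets B"
    using T by (auto simp: closedin_def intro: sigma_sets.Basic)
  then have "space B - (space B - {b}) \<in> sets B"
    by blast
  then show ?thesis
    using assms(2) by (simp add: double_diff)
qed

text \<open>The discrete topology is the witness; the lemma supplies the auxiliary two-point target
  space.\<close>

lemma standard_borel_count_space:
  assumes "countable S"
  shows "standard_borel (count_space S)"
  unfolding standard_borel_def
proof (intro exI conjI)
  show "completely_metrizable_space (discrete_topology S)"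
    by (rule completely_metrizable_space_discrete_topology)
  show "separable_space (discrete_topology S)"
    using assms by (simp add: separable_space_discrete_topology)
  show "sets (count_space S) = sigma_sets (topspace (discrete_topology S)) {U. openin (discrete_topology S) U}"
    by (simp add: sigma_algebra.sigma_sets_eq[OF sigma_algebra_Pow] flip: Pow_def)
qed simp

context
  fixes B :: "'b measure" and b c :: 'b
  assumes b: "b \<in> space B" and c: "c \<in> space B" and neq: "b \<noteq> c"
begin

lemma osc_indicator_origin: "osc B (\<lambda>y. indicator {b} (y 0)) j = of_bool (j = (0 :: int ^ 'd))"
proof (cases "j = 0")
  case True
  show ?thesis
    unfolding osc_def
  proof (rule antisym, rule Sup_least, goal_cases)
    case 2
    \<comment> \<open>The value 1 is attained by the configuration constantly \<open>b\<close> and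
      its change to \<open>c\<close> at the origin.\<close>
    show ?case
      using b c neq True
      by (intro Sup_upper CollectI exI[of _ "\<lambda>_. b"] exI[of _ "(\<lambda>_. b)(0 := c)"])
        (auto simp: space_PiM)
  qed (use True in \<open>auto simp: indicator_def\<close>)
next
  case False
  then show ?thesis
    unfolding osc_def by (intro antisym Sup_least) auto
qed

lemma dep_indicator_origin: "dep B (\<lambda>y. indicator {b} (y (0 :: int ^ 'd))) = {0}"
  by (auto simp: dep_def osc_indicator_origin)

lemma osc_norm_sq_indicator_origin:
  "osc_norm_sq B (\<lambda>y. indicator {b} (y (0 :: int ^ 'd))) = 1"
proof -
  have "osc_norm_sq B (\<lambda>y. indicator {b} (y (0 :: int ^ 'd)))
      = (\<Sum>\<^sub>\<infinity>j\<in>{0 :: int ^ 'd}. 1)"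
    unfolding osc_norm_sq_def osc_indicator_origin by (rule infsum_cong_neutral) auto
  then show ?thesis by simp
qed

lemma local_observable_indicator_origin:
  assumes "standard_borel B"
  shows "local_observable B (\<lambda>y. indicator {b} (y (0 :: int ^ 'd)))"
proof -
  note [measurable] = standard_borel_singleton_sets[OF assms b]
  show ?thesis
    by (auto simp: local_observable_def dep_indicator_origin)
qed

text \<open>Only \<open>j = 0\<close> contributes to the influence, and
  \<open>shift 0 x = x\<close>. What remains is the condition \<open>linf (- i) \<le> r\<close> with
  \<open>r\<close> the truncated radius at \<open>x\<close>, and the ball is symmetric. Squaring an
  indicator changes nothing.\<close>

lemma sum_influence_sq_indicator_origin:
  "(\<Sum>\<^sub>\<infinity>i :: int ^ 'd. (influence A B \<phi> (\<lambda>y. indicator {b} (y 0)) n i x)\<^sup>2)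
    = of_nat (card (linf_ball (truncated_radius A \<phi> n x) :: (int ^ 'd) set))"
proof -
  let ?S = "linf_ball (truncated_radius A \<phi> n x) :: (int ^ 'd) set"
  have "(\<Sum>\<^sub>\<infinity>i. (influence A B \<phi> (\<lambda>y. indicator {b} (y 0)) n i x)\<^sup>2) = (\<Sum>\<^sub>\<infinity>i\<in>?S. 1)"
    by (rule infsum_cong_neutral)
      (auto simp: influence_def dep_indicator_origin osc_indicator_origin linf_ball_def
        linf_uminus shift_def)
  then show ?thesis
    by (simp add: finite_linf_ball)
qed

end

theorem proposition3p4:
  fixes K :: real
    and \<Psi> :: "'w measure \<Rightarrow> ('w \<Rightarrow> nat) \<Rightarrow> ereal"
  assumes K_pos: "0 < K"
    and mono: "nondecreasing_functional \<Psi>"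
    and nontrivial_type: "\<exists>u v :: 'b. u \<noteq> v"
    and bound: "\<And>(A :: 'a measure) (B :: 'b measure) (M :: 'w measure)
          (X :: 'w \<Rightarrow> int ^ 'd \<Rightarrow> 'a) \<phi> f n.
        \<lbrakk>standard_borel A; standard_borel B; iid_input M A X; finitary_coding A B M X \<phi>;
          local_observable B f; 1 \<le> n\<rbrakk> \<Longrightarrow>
        enn2ereal (\<integral>\<^sup>+ \<omega>. (\<Sum>\<^sub>\<infinity>i. (influence A B \<phi> f n i (X \<omega>))\<^sup>2) \<partial>M)
          \<le> ereal K * enn2ereal (osc_norm_sq B f) * \<Psi> M (\<lambda>\<omega>. truncated_radius A \<phi> n (X \<omega>))"
  shows "\<And>(A :: 'a measure) (B :: 'b measure) (M :: 'w measure)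
          (X :: 'w \<Rightarrow> int ^ 'd \<Rightarrow> 'a) \<phi> n.
        \<lbrakk>standard_borel A; standard_borel B; iid_input M A X; finitary_coding A B M X \<phi>;
          1 \<le> n\<rbrakk> \<Longrightarrow>
        enn2ereal (\<integral>\<^sup>+ \<omega>. of_nat (card (linf_ball (truncated_radius A \<phi> n (X \<omega>)) :: (int ^ 'd) set)) \<partial>M)
          \<le> ereal K * \<Psi> M (\<lambda>\<omega>. truncated_radius A \<phi> n (X \<omega>))"
proof -
  fix A :: "'a measure" and B :: "'b measure" and M :: "'w measure"
    and X :: "'w \<Rightarrow> int ^ 'd \<Rightarrow> 'a" and \<phi> and n :: nat
  assume A: "standard_borel A" and B: "standard_borel B" and X: "iid_input M A X"
    and \<phi>: "finitary_coding A B M X \<phi>" and n: "1 \<le> n"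
  \<comment> \<open>Target space and coding are kept general, since the degenerate case replaces
    both.\<close>
  have two_points: "enn2ereal (\<integral>\<^sup>+ \<omega>. of_nat (card (linf_ball (truncated_radius A \<phi>' n (X \<omega>)) :: (int ^ 'd) set)) \<partial>M)
      \<le> ereal K * \<Psi> M (\<lambda>\<omega>. truncated_radius A \<phi>' n (X \<omega>))"
    if "standard_borel B'" "finitary_coding A B' M X \<phi>'"
      and pts: "b \<in> space B'" "c \<in> space B'" "b \<noteq> c" for B' :: "'b measure" and \<phi>' b c
    using bound[OF A that(1) X that(2) local_observable_indicator_origin[OF pts that(1)] n]
    by (simp add: sum_influence_sq_indicator_origin[OF pts] osc_norm_sq_indicator_origin[OF pts]
      one_ennreal.rep_eq)
  interpret prob_space M
    using X by (simp add: iid_input_def)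
  have X_space: "X \<omega> \<in> space (config A)" if "\<omega> \<in> space M" for \<omega>
    using X that by (auto simp: iid_input_def dest: measurable_space)
  have \<phi>_space: "\<phi> x i \<in> space B" if "x \<in> space (config A)" for x i
    using \<phi> that by (auto simp: finitary_coding_def coding_map_def space_PiM PiE_iff
        dest!: measurable_space)
  show "enn2ereal (\<integral>\<^sup>+ \<omega>. of_nat (card (linf_ball (truncated_radius A \<phi> n (X \<omega>)) :: (int ^ 'd) set)) \<partial>M)
      \<le> ereal K * \<Psi> M (\<lambda>\<omega>. truncated_radius A \<phi> n (X \<omega>))"
  proof (cases "\<exists>b\<in>space B. \<exists>c\<in>space B. b \<noteq> c")
    case True
    then show ?thesis
      using two_points[OF B \<phi>] by blast
  next
    case False
    have \<phi>_zero: "truncated_radius A \<phi> n (X \<omega>) = 0" if "\<omega> \<in> space M" for \<omega>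
      by (intro truncated_radius_eq_0 coding_radius_eq_0) (use False \<phi>_space X_space[OF that] in blast)
    obtain u v :: 'b where uv: "u \<noteq> v"
      using nontrivial_type by blast
    \<comment> \<open>The replacement coding has the same input \<open>X\<close> and also radius 0,
      but its target \<open>{u, v}\<close> has the second point that \<open>two_points\<close>
      requires.\<close>
    define \<phi>' :: "(int ^ 'd \<Rightarrow> 'a) \<Rightarrow> int ^ 'd \<Rightarrow> 'b" where "\<phi>' = (\<lambda>_ _. u)"
    have radius_\<phi>': "coding_radius A \<phi>' x = 0" for x
      by (rule coding_radius_eq_0) (simp add: \<phi>'_def)
    then have \<phi>'_zero: "truncated_radius A \<phi>' n x = 0" for x
      by (rule truncated_radius_eq_0)
    have \<phi>': "finitary_coding A (count_space {u, v}) M X \<phi>'"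
      by (auto simp: finitary_coding_def radius_\<phi>')
        (auto simp: coding_map_def \<phi>'_def shift_def space_PiM intro!: measurable_const)
    have "(\<integral>\<^sup>+ \<omega>. of_nat (card (linf_ball (truncated_radius A \<phi> n (X \<omega>)) :: (int ^ 'd) set)) \<partial>M)
        = (\<integral>\<^sup>+ \<omega>. of_nat (card (linf_ball (truncated_radius A \<phi>' n (X \<omega>)) :: (int ^ 'd) set)) \<partial>M)"
      by (rule nn_integral_cong) (simp add: \<phi>_zero \<phi>'_zero)
    also have "enn2ereal \<dots> \<le> ereal K * \<Psi> M (\<lambda>\<omega>. truncated_radius A \<phi>' n (X \<omega>))"
      by (rule two_points[OF standard_borel_count_space \<phi>', of u v]) (use uv in auto)
    also have "\<dots> \<le> ereal K * \<Psi> M (\<lambda>\<omega>. truncated_radius A \<phi> n (X \<omega>))"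
    \<comment> \<open>The two radii are known to agree only on \<open>space M\<close>, so the values
      of \<open>\<Psi>\<close> are compared by monotonicity rather than by equality of functions.
      Its measurability condition for the radius of \<open>\<phi>\<close> is transferred from the
      constant 0.\<close>
    proof (rule ereal_mult_left_mono)
      have "(\<lambda>\<omega>. truncated_radius A \<phi> n (X \<omega>)) \<in> completion M \<rightarrow>\<^sub>M count_space UNIV
          \<longleftrightarrow> (\<lambda>_. 0 :: nat) \<in> completion M \<rightarrow>\<^sub>M count_space UNIV"
        by (rule measurable_cong) (simp add: \<phi>_zero)
      then show "\<Psi> M (\<lambda>\<omega>. truncated_radius A \<phi>' n (X \<omega>)) \<le> \<Psi> M (\<lambda>\<omega>. truncated_radius A \<phi> n (X \<omega>))"
        using mono prob_space_axioms by (simp add: nondecreasing_functional_def \<phi>'_zero)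
    qed (use K_pos in simp)
    finally show ?thesis .
  qed
qed

end
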